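(* Let $D=(F,R,>)$ be a finite propositional defeasible theory, $q$ a literal, and let $E=(+\Delta_E,-\Delta_E,+\partial_E,-\partial_E)=\bigcup_{n<\omega}\mathcal{T}_D\uparrow n$ be the limit (pointwise union) of all finite elements of the Kleene sequence of $\mathcal{T}_D$ from $\bot$. Then: $D\vdash+\Delta q$ iff $q\in+\Delta_E$; $D\vdash-\Delta q$ iff $q\in-\Delta_E$; $D\vdash+\partial q$ iff $q\in+\partial_E$; $D\vdash-\partial q$ iff $q\in-\partial_E$.
   Context: Literals are atoms $p$ or negated atoms $\neg p$; for a literal $q$, $\sim q$ is its complement. A defeasible theory $D=(F,R,>)$ consists of a finite set $F$ of literals (facts), a finite set $R$ of propositional rules, and a binary relation $>$ on $R$ whose transitive closure is irreflexive. Each rule $r$ has a unique label, an antecedent $A(r)$ (finite set of literals), a head $C(r)$ (a literal) and a kind: strict ($\to$), defeasible ($\Rightarrow$) or defeater ($\leadsto$). $R_s$: strict rules; $R_{sd}$: strict or defeasible rules; $R[q]$, $R_s[q]$, $R_{sd}[q]$: those with head $q$. A derivation in $D$ is a finite sequence $P(1),\dots,P(n)$ of tagged literals $+\Delta q,-\Delta q,+\partial q,-\partial q$ such that for each $i$ (with $P(1..i)$ the initial segment of length $i$): ($+\Delta$) if $P(i+1)=+\Delta q$ then $q\in F$ or $\exists r\in R_s[q]\,\forall a\in A(r):+\Delta a\in P(1..i)$; ($-\Delta$) if $P(i+1)=-\Delta q$ then $q\notin F$ and $\forall r\in R_s[q]\,\exists a\in A(r): -\Delta a\in P(1..i)$;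 ($+\partial$) if $P(i+1)=+\partial q$ then either $+\Delta q\in P(1..i)$, or: $\exists r\in R_{sd}[q]\,\forall a\in A(r):+\partial a\in P(1..i)$, and $-\Delta\sim q\in P(1..i)$, and for every $s\in R[\sim q]$ either $\exists a\in A(s):-\partial a\in P(1..i)$ or $\exists t\in R_{sd}[q]$ with $t>s$ and $\forall a\in A(t):+\partial a\in P(1..i)$; ($-\partial$) if $P(i+1)=-\partial q$ then $-\Delta q\in P(1..i)$ and either $\forall r\in R_{sd}[q]\,\exists a\in A(r):-\partial a\in P(1..i)$, or $+\Delta\sim q\in P(1..i)$, or $\exists s\in R[\sim q]$ with $\forall a\in A(s):+\partial a\in P(1..i)$ and for every $t\in R_{sd}[q]$ either $\exists a\in A(t):-\partial a\in P(1..i)$ or $t\not> s$. $D\vdash L$ means $L$ occurs in some derivation in $D$. An extension is a 4-tuple $(+\Delta,-\Delta,+\partial,-\partial)$ of sets of literals, ordered pointwise by inclusion, with least element $\bot=(\emptyset,\emptyset,\emptyset,\emptyset)$. The operator $\mathcal{T}_D(+\Delta,-\Delta,+\partial,-\partial)=(+\Delta',-\Delta',+\partial',-\partial')$ is: $+\Delta'=F\cup\{q\mid\exists r\in R_s[q]:A(r)\subseteq+\Delta\}$; $-\Delta'=-\Delta\cup(\{q\mid\forall r\in R_s[q]:A(r)\cap-\Delta\neq\emptyset\}\setminus F)$; $+\partial'=+\Delta\cup\{q\mid \exists r\in R_{sd}[q]:A(r)\subseteq+\partial$, $\sim q\in-\Delta$, and $\forall s\in R[\sim q]$ either $A(s)\cap-\partial\neq\emptyset$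 or $\exists t\in R_{sd}[q]$ with $A(t)\subseteq+\partial$ and $t>s\}$; $-\partial'=\{q\in-\Delta\mid (\forall r\in R_{sd}[q]:A(r)\cap-\partial\neq\emptyset)$, or $\sim q\in+\Delta$, or $\exists s\in R[\sim q]$ with $A(s)\subseteq+\partial$ and $\forall t\in R_{sd}[q]$ either $A(t)\cap-\partial\neq\emptyset$ or $t\not>s\}$. The Kleene sequence is $\mathcal{T}_D\uparrow 0=\bot$, $\mathcal{T}_D\uparrow(n+1)=\mathcal{T}_D(\mathcal{T}_D\uparrow n)$. *)

theory Defs
  imports Main "HOL-Library.Product_Order"
begin

datatype 'a literal = Pos 'a | Neg 'a

fun compl :: "'a literal \<Rightarrow> 'a literal" where
  "compl (Pos p) = Neg p"
| "compl (Neg p) = Pos p"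

datatype rule_kind = Strict | Defeasible | Defeater

datatype ('l, 'a) rule =
  Rule (label: 'l) (antecedent: "'a literal set") (kind: rule_kind) (head: "'a literal")

(* A pair (t, s) in the superiority relation means t > s. *)
datatype ('l, 'a) dtheory =
  DTheory (facts: "'a literal set") (rules: "('l, 'a) rule set")
    (superiority: "(('l, 'a) rule \<times> ('l, 'a) rule) set")

definition defeasible_theory :: "('l, 'a) dtheory \<Rightarrow> bool" where
  "defeasible_theory D \<longleftrightarrow>
     finite (facts D) \<and> finite (rules D) \<and>
     (\<forall>r\<in>rules D. finite (antecedent r)) \<and>
     inj_on label (rules D) \<and>
     superiority D \<subseteq> rules D \<times> rules D \<and>
     irrefl ((superiority D)\<^sup>+)"

definition superior :: "('l, 'a) dtheory \<Rightarrow> ('l, 'a) rule \<Rightarrow> ('l, 'a) rule \<Rightarrow> bool" where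
  "superior D t s \<longleftrightarrow> (t, s) \<in> superiority D"

definition rules_for :: "('l, 'a) dtheory \<Rightarrow> 'a literal \<Rightarrow> ('l, 'a) rule set" where
  "rules_for D q = {r \<in> rules D. head r = q}"

definition strict_for :: "('l, 'a) dtheory \<Rightarrow> 'a literal \<Rightarrow> ('l, 'a) rule set" where
  "strict_for D q = {r \<in> rules_for D q. kind r = Strict}"

definition supportive_for :: "('l, 'a) dtheory \<Rightarrow> 'a literal \<Rightarrow> ('l, 'a) rule set" where
  "supportive_for D q = {r \<in> rules_for D q. kind r = Strict \<or> kind r = Defeasible}"

(* +Delta q, -Delta q, +partial q and -partial q, respectively. *)
datatype 'a tagged =
    PlusDelta "'a literal" | MinusDelta "'a literal"
  | PlusPartial "'a literal" | MinusPartial "'a literal"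

(* In the inference conditions X is the set of tagged literals occurring in P(1..i). *)

definition plus_Delta_cond :: "('l, 'a) dtheory \<Rightarrow> 'a tagged set \<Rightarrow> 'a literal \<Rightarrow> bool" where
  "plus_Delta_cond D X q \<longleftrightarrow>
     q \<in> facts D \<or> (\<exists>r\<in>strict_for D q. \<forall>a\<in>antecedent r. PlusDelta a \<in> X)"

definition minus_Delta_cond :: "('l, 'a) dtheory \<Rightarrow> 'a tagged set \<Rightarrow> 'a literal \<Rightarrow> bool" where
  "minus_Delta_cond D X q \<longleftrightarrow>
     q \<notin> facts D \<and> (\<forall>r\<in>strict_for D q. \<exists>a\<in>antecedent r. MinusDelta a \<in> X)"

definition plus_partial_cond :: "('l, 'a) dtheory \<Rightarrow> 'a tagged set \<Rightarrow> 'a literal \<Rightarrow> bool" where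
  "plus_partial_cond D X q \<longleftrightarrow>
     PlusDelta q \<in> X \<or>
     ((\<exists>r\<in>supportive_for D q. \<forall>a\<in>antecedent r. PlusPartial a \<in> X) \<and>
      MinusDelta (compl q) \<in> X \<and>
      (\<forall>s\<in>rules_for D (compl q).
         (\<exists>a\<in>antecedent s. MinusPartial a \<in> X) \<or>
         (\<exists>t\<in>supportive_for D q. superior D t s \<and> (\<forall>a\<in>antecedent t. PlusPartial a \<in> X))))"

definition minus_partial_cond :: "('l, 'a) dtheory \<Rightarrow> 'a tagged set \<Rightarrow> 'a literal \<Rightarrow> bool" where
  "minus_partial_cond D X q \<longleftrightarrow>
     MinusDelta q \<in> X \<and>
     ((\<forall>r\<in>supportive_for D q. \<exists>a\<in>antecedent r. MinusPartial a \<in> X) \<or>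
      PlusDelta (compl q) \<in> X \<or>
      (\<exists>s\<in>rules_for D (compl q).
         (\<forall>a\<in>antecedent s. PlusPartial a \<in> X) \<and>
         (\<forall>t\<in>supportive_for D q.
            (\<exists>a\<in>antecedent t. MinusPartial a \<in> X) \<or> \<not> superior D t s)))"

fun inference_cond :: "('l, 'a) dtheory \<Rightarrow> 'a tagged set \<Rightarrow> 'a tagged \<Rightarrow> bool" where
  "inference_cond D X (PlusDelta q) = plus_Delta_cond D X q"
| "inference_cond D X (MinusDelta q) = minus_Delta_cond D X q"
| "inference_cond D X (PlusPartial q) = plus_partial_cond D X q"
| "inference_cond D X (MinusPartial q) = minus_partial_cond D X q"

(* List indices start at 0, so P ! i is P(i+1) and take i P is P(1..i). *)
definition derivation :: "('l, 'a) dtheory \<Rightarrow> 'a tagged list \<Rightarrow> bool" where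
  "derivation D P \<longleftrightarrow> (\<forall>i<length P. inference_cond D (set (take i P)) (P ! i))"

definition derives :: "('l, 'a) dtheory \<Rightarrow> 'a tagged \<Rightarrow> bool" where
  "derives D L \<longleftrightarrow> (\<exists>P. derivation D P \<and> L \<in> set P)"

(* Components in the order +Delta, -Delta, +partial, -partial. The order, the bottom element
   and suprema are the componentwise ones of Product_Order. *)
type_synonym 'a extension =
  "'a literal set \<times> 'a literal set \<times> 'a literal set \<times> 'a literal set"

fun T_op :: "('l, 'a) dtheory \<Rightarrow> 'a extension \<Rightarrow> 'a extension" where
  "T_op D (pD, mD, pd, md) =
    (facts D \<union> {q. \<exists>r\<in>strict_for D q. antecedent r \<subseteq> pD},
     mD \<union> ({q. \<forall>r\<in>strict_for D q. antecedent r \<inter> mD \<noteq> {}} - facts D),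
     pD \<union> {q. (\<exists>r\<in>supportive_for D q. antecedent r \<subseteq> pd) \<and>
               compl q \<in> mD \<and>
               (\<forall>s\<in>rules_for D (compl q).
                  antecedent s \<inter> md \<noteq> {} \<or>
                  (\<exists>t\<in>supportive_for D q. antecedent t \<subseteq> pd \<and> superior D t s))},
     {q \<in> mD. (\<forall>r\<in>supportive_for D q. antecedent r \<inter> md \<noteq> {}) \<or>
               compl q \<in> pD \<or>
               (\<exists>s\<in>rules_for D (compl q).
                  antecedent s \<subseteq> pd \<and>
                  (\<forall>t\<in>supportive_for D q. antecedent t \<inter> md \<noteq> {} \<or> \<not> superior D t s))})"

primrec kleene :: "('l, 'a) dtheory \<Rightarrow> nat \<Rightarrow> 'a extension" where
  "kleene D 0 = bot"
| "kleene D (Suc n) = T_op D (kleene D n)"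

end

theory Submission
  imports Defs
begin

text \<open>
  Collecting the four components of an extension into one set of tagged literals turns
  \<open>T_op D\<close> into the monotone operator that infers everything possible in one step (and keeps
  the earlier \<open>-\<Delta>\<close> conclusions). A derivation is therefore contained in some Kleene stage, by induction on its
  length. Conversely, an inference consults only the finitely many tagged literals built
  from antecedents of rules and from its own conclusion, so the derivations of its premises
  can be concatenated into a single one.
\<close>

fun tagged_set :: "'a extension \<Rightarrow> 'a tagged set" where
  "tagged_set (pD, mD, pd, md) =
     PlusDelta ` pD \<union> MinusDelta ` mD \<union> PlusPartial ` pd \<union> MinusPartial ` md"

lemma in_tagged_set [simp]:
  "PlusDelta q \<in> tagged_set E \<longleftrightarrow> q \<in> fst E"
  "MinusDelta q \<in> tagged_set E \<longleftrightarrow> q \<in> fst (snd E)"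
  "PlusPartial q \<in> tagged_set E \<longleftrightarrow> q \<in> fst (snd (snd E))"
  "MinusPartial q \<in> tagged_set E \<longleftrightarrow> q \<in> snd (snd (snd E))"
  by (cases E; auto)+

text \<open>Bounded-quantifier companions of \<open>disj_forward\<close> and
  \<open>conj_forward\<close>, so that monotonicity can be checked by descending through a
  formula.\<close>

lemma ball_forward:
  "\<forall>x\<in>A. P x \<Longrightarrow> (\<And>x. P x \<Longrightarrow> Q x) \<Longrightarrow> \<forall>x\<in>A. Q x"
  by blast

lemma bex_forward:
  "\<exists>x\<in>A. P x \<Longrightarrow> (\<And>x. P x \<Longrightarrow> Q x) \<Longrightarrow> \<exists>x\<in>A. Q x"
  by blast

text \<open>Membership in \<open>X\<close> occurs only positively: failure is expressed by the minus
  tags, never by absence from \<open>X\<close>. The negations that do occur concern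
  \<open>facts D\<close> and \<open>superior D\<close>, which do not depend on
  \<open>X\<close>.\<close>

lemma inference_cond_mono:
  assumes "inference_cond D X L" "X \<subseteq> Y"
  shows "inference_cond D Y L"
  by (cases L; insert assms(1); hypsubst; unfold inference_cond.simps plus_Delta_cond_def
      minus_Delta_cond_def plus_partial_cond_def minus_partial_cond_def;
      elim disj_forward conj_forward bex_forward ball_forward subsetD[OF assms(2)]; assumption)

lemma tagged_set_T_op:
  fixes D :: "('l, 'a) dtheory"
  shows "L \<in> tagged_set (T_op D E) \<longleftrightarrow>
     inference_cond D (tagged_set E) L \<or> (L \<in> tagged_set E \<and> L \<in> range MinusDelta)"
proof -
  obtain pD mD pd md where E: "E = (pD, mD, pd, md)" by (cases E)
  \<comment> \<open>Turns the intersections in \<open>T_op\<close> into the bounded existentials of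
    the inference conditions.\<close>
  have disj: "A \<inter> B = {} \<longleftrightarrow> \<not> (\<exists>a\<in>A. a \<in> B)" for A B :: "'a literal set"
    by blast
  show ?thesis
    unfolding E
    by (cases L)
      (simp_all add: plus_Delta_cond_def minus_Delta_cond_def plus_partial_cond_def
        minus_partial_cond_def subset_eq disj image_iff conj_commute disj_commute
        del: tagged_set.simps)
qed

lemma tagged_set_T_op_mono:
  "tagged_set E \<subseteq> tagged_set E' \<Longrightarrow> tagged_set (T_op D E) \<subseteq> tagged_set (T_op D E')"
  using inference_cond_mono[of D "tagged_set E" _ "tagged_set E'"]
  by (auto simp: tagged_set_T_op)

text \<open>The chain starts at the least element, and monotonicity of \<open>T_op\<close>
  propagates each inclusion to the next stage.\<close>

lemma tagged_set_kleene_mono: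
  "m \<le> n \<Longrightarrow> tagged_set (kleene D m) \<subseteq> tagged_set (kleene D n)"
proof (rule lift_Suc_mono_le [of "\<lambda>n. tagged_set (kleene D n)"])
  show "tagged_set (kleene D n) \<subseteq> tagged_set (kleene D (Suc n))" for n
  proof (induction n)
    case 0
    show ?case by (simp add: bot_prod_def)
  next
    case (Suc n)
    then show ?case by (simp add: tagged_set_T_op_mono)
  qed
qed

lemma derivation_Nil [simp]: "derivation D []"
  by (simp add: derivation_def)

lemma derivation_snoc [simp]:
  "derivation D (P @ [L]) \<longleftrightarrow> derivation D P \<and> inference_cond D (set P) L"
  by (auto simp: derivation_def nth_append less_Suc_eq)

text \<open>Putting \<open>P\<close> in front only enlarges the set of tagged literals available to
  each step of \<open>Q\<close>.\<close>

lemma derivation_append: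
  "derivation D P \<Longrightarrow> derivation D Q \<Longrightarrow> derivation D (P @ Q)"
proof (induction Q rule: rev_induct)
  case (snoc L Q)
  then have "derivation D ((P @ Q) @ [L])"
    using inference_cond_mono[of D "set Q" L "set (P @ Q)"] by (simp del: append_assoc)
  then show ?case by simp
qed simp

lemma derivation_subset_kleene:
  "derivation D P \<Longrightarrow> \<exists>n. set P \<subseteq> tagged_set (kleene D n)"
proof (induction P rule: rev_induct)
  case (snoc L P)
  then obtain n where n: "set P \<subseteq> tagged_set (kleene D n)" by auto
  with snoc.prems have "L \<in> tagged_set (kleene D (Suc n))"
    using inference_cond_mono[OF _ n, of D L] by (simp add: tagged_set_T_op)
  \<comment> \<open>\<open>T_op\<close> explicitly retains only the \<open>MinusDelta\<close> part;
    the other conclusions persist because the chain increases.\<close>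
  moreover have "set P \<subseteq> tagged_set (kleene D (Suc n))"
    using n tagged_set_kleene_mono[of n "Suc n" D] by (meson le_SucI order_refl order_trans)
  ultimately show ?case by (intro exI[of _ "Suc n"]) simp
qed simp

lemma finite_subset_derivation:
  assumes "finite X" "\<forall>L\<in>X. derives D L"
  shows "\<exists>P. derivation D P \<and> X \<subseteq> set P"
  using assms
proof (induction X rule: finite_induct)
  case empty
  show ?case by (intro exI[of _ "[]"]) simp
next
  case (insert L X)
  then obtain P Q where "derivation D P" "X \<subseteq> set P" "derivation D Q" "L \<in> set Q"
    by (auto simp: derives_def)
  then show ?case by (intro exI[of _ "P @ Q"]) (auto intro: derivation_append)
qed

lemma inference_cond_finite:
  assumes "finite (rules D)" "\<forall>r\<in>rules D. finite (antecedent r)" "inference_cond D X L"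
  shows "\<exists>Y\<subseteq>X. finite Y \<and> inference_cond D Y L"
proof -
  \<comment> \<open>Every literal that an inference of a conclusion about \<open>q\<close> can look
    up; \<open>compl q\<close> covers the tests on the complement in the two partial
    conditions.\<close>
  define lits where "lits q = (\<Union>r\<in>rules D. antecedent r) \<union> {q, compl q}" for q
  define Y where
    "Y q = X \<inter> tagged_set (lits q, lits q, lits q, lits q)" for q
  have fin: "finite (Y q)" for q
    using assms(1,2) by (simp add: Y_def lits_def)
  have sub: "Y q \<subseteq> X" for q by (simp add: Y_def)
  have own: "PlusDelta q \<in> Y q \<longleftrightarrow> PlusDelta q \<in> X"
    "MinusDelta q \<in> Y q \<longleftrightarrow> MinusDelta q \<in> X"
    "PlusDelta (compl q) \<in> Y q \<longleftrightarrow> PlusDelta (compl q) \<in> X"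
    "MinusDelta (compl q) \<in> Y q \<longleftrightarrow> MinusDelta (compl q) \<in> X" for q
    by (simp_all add: Y_def lits_def del: tagged_set.simps)
  have ante: "PlusDelta a \<in> Y q \<longleftrightarrow> PlusDelta a \<in> X"
    "MinusDelta a \<in> Y q \<longleftrightarrow> MinusDelta a \<in> X"
    "PlusPartial a \<in> Y q \<longleftrightarrow> PlusPartial a \<in> X"
    "MinusPartial a \<in> Y q \<longleftrightarrow> MinusPartial a \<in> X"
    if "r \<in> rules D" "a \<in> antecedent r" for a q r
    using that by (auto simp: Y_def lits_def simp del: tagged_set.simps)
  have all_ante:
    "(\<forall>a\<in>antecedent r. PlusDelta a \<in> Y q) \<longleftrightarrow> (\<forall>a\<in>antecedent r. PlusDelta a \<in> X)"
    "(\<forall>a\<in>antecedent r. PlusPartial a \<in> Y q) \<longleftrightarrow> (\<forall>a\<in>antecedent r. PlusPartial a \<in> X)"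
    "(\<exists>a\<in>antecedent r. MinusDelta a \<in> Y q) \<longleftrightarrow> (\<exists>a\<in>antecedent r. MinusDelta a \<in> X)"
    "(\<exists>a\<in>antecedent r. MinusPartial a \<in> Y q) \<longleftrightarrow> (\<exists>a\<in>antecedent r. MinusPartial a \<in> X)"
    if "r \<in> rules D" for q r
    using ante[OF that] by simp_all
  have rules: "r \<in> strict_for D q \<Longrightarrow> r \<in> rules D" "r \<in> supportive_for D q \<Longrightarrow> r \<in> rules D"
    "r \<in> rules_for D q \<Longrightarrow> r \<in> rules D" for q r
    by (auto simp: strict_for_def supportive_for_def rules_for_def)
  \<comment> \<open>The witness is the literal under the tag of \<open>L\<close>. For it,
    \<open>Y q\<close> and \<open>X\<close> agree on all tagged literals consulted.\<close>
  have "\<exists>q. inference_cond D (Y q) L \<longleftrightarrow> inference_cond D X L"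
    by (cases L)
      (auto simp: plus_Delta_cond_def minus_Delta_cond_def plus_partial_cond_def
        minus_partial_cond_def own all_ante rules cong: ball_cong bex_cong
        intro!: exI[of _ "case L of PlusDelta q \<Rightarrow> q | MinusDelta q \<Rightarrow> q
          | PlusPartial q \<Rightarrow> q | MinusPartial q \<Rightarrow> q"])
  then show ?thesis using fin sub assms(3) by blast
qed

text \<open>Finitely many premises suffice, one derivation contains them all, and \<open>L\<close>
  can be appended to it.\<close>

lemma derives_closed:
  assumes "finite (rules D)" "\<forall>r\<in>rules D. finite (antecedent r)"
    and "inference_cond D {L. derives D L} L"
  shows "derives D L"
proof -
  obtain Y where "Y \<subseteq> {L. derives D L}" "finite Y" "inference_cond D Y L"
    using inference_cond_finite[OF assms] by blast
  moreover from this obtain P where "derivation D P" "Y \<subseteq> set P"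
    using finite_subset_derivation[of Y D] by blast
  ultimately have "derivation D (P @ [L])"
    using inference_cond_mono[of D Y L "set P"] by simp
  then show ?thesis unfolding derives_def by (meson in_set_conv_decomp)
qed

lemma kleene_derives:
  assumes "finite (rules D)" "\<forall>r\<in>rules D. finite (antecedent r)"
  shows "tagged_set (kleene D n) \<subseteq> {L. derives D L}"
proof (induction n)
  case 0
  show ?case by (simp add: bot_prod_def)
next
  case (Suc n)
  show ?case
  proof
    fix L assume "L \<in> tagged_set (kleene D (Suc n))"
    then have "inference_cond D (tagged_set (kleene D n)) L \<or> L \<in> tagged_set (kleene D n)"
      by (auto simp: tagged_set_T_op)
    then show "L \<in> {L. derives D L}"
      using Suc derives_closed[OF assms] inference_cond_mono[OF _ Suc] by blast
  qed
qed

lemma derives_iff_kleene: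
  assumes "finite (rules D)" "\<forall>r\<in>rules D. finite (antecedent r)"
  shows "derives D L \<longleftrightarrow> (\<exists>n. L \<in> tagged_set (kleene D n))"
  using kleene_derives[OF assms] derivation_subset_kleene[of D]
  unfolding derives_def by blast

theorem theorem2p2:
  fixes D :: "('l, 'a) dtheory" and q :: "'a literal"
    and pD mD pd md :: "'a literal set"
  assumes "defeasible_theory D"
    and "(pD, mD, pd, md) = (SUP n. kleene D n)"
  shows "(derives D (PlusDelta q) \<longleftrightarrow> q \<in> pD) \<and>
         (derives D (MinusDelta q) \<longleftrightarrow> q \<in> mD) \<and>
         (derives D (PlusPartial q) \<longleftrightarrow> q \<in> pd) \<and>
         (derives D (MinusPartial q) \<longleftrightarrow> q \<in> md)"
proof -
  have "finite (rules D)" "\<forall>r\<in>rules D. finite (antecedent r)"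
    using assms(1) by (auto simp: defeasible_theory_def)
  note iff = derives_iff_kleene[OF this]
  \<comment> \<open>Suprema in the product order are componentwise, so belonging to a component of
    the limit means belonging to that component of some stage.\<close>
  have "pD = (\<Union>n. fst (kleene D n))" "mD = (\<Union>n. fst (snd (kleene D n)))"
    "pd = (\<Union>n. fst (snd (snd (kleene D n))))" "md = (\<Union>n. snd (snd (snd (kleene D n))))"
    using assms(2) by (simp_all add: Sup_prod_def image_image)
  then show ?thesis by (simp add: iff)
qed

end
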